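(* Let $i,j\in\mathbb{S}$ be orthogonal and let $\mu_i$ be a non-trivial $q$-positive probability measure on $\mathbb{T}_i$ with Verblunsky coefficients $(\gamma_n)_{n=0}^\infty$ and orthonormal polynomials $(\psi_n^L)_{n=0}^\infty$ and $(\psi_n^R)_{n=0}^\infty$. Set $r_n:=\sqrt{1-|\gamma_n|^2}$. Then for all integers $n\ge 0$ and all $p\in\mathbb{H}$, $$\psi_n^L(p)\,p-r_n\,\psi_{n+1}^L(p)=\overline{\gamma_n}\,\psi_n^{R,\#}(p),$$ $$p\,\psi_n^R(p)-\psi_{n+1}^R(p)\,r_n=\psi_n^{L,\#}(p)\,\overline{\gamma_n}.$$
   Context: $\mathbb{H}$ is the quaternions, $\mathbb{S}$ the sphere of purely imaginary unit quaternions (so $i^2=-1$ for $i\in\mathbb{S}$). For $i\in\mathbb{S}$: $\mathbb{C}_i=\mathbb{R}+\mathbb{R}i$, $\mathbb{T}_i$ is its unit circle. If $i,j\in\mathbb{S}$ are orthogonal (as vectors in $\mathbb{R}^3$), every quaternion is uniquely $p^{(1)}+p^{(2)}j$ with $p^{(1)},p^{(2)}\in\mathbb{C}_i$. A quaternion-valued measure $\mu_i=\mu^{(1)}+\mu^{(2)}j$ on $\mathbb{T}_i$ ($\mu^{(1)},\mu^{(2)}$ being $\mathbb{C}_i$-valued) is $q$-positive if $\mu^{(1)}$ is a positive measure, $\int_0^{2\pi} e^{in\theta}\mathrm{d}\mu^{(2)}(\theta)=-\int_0^{2\pi} e^{-in\theta}\mathrm{d}\mu^{(2)}(\theta)$ for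 all $n\in\mathbb{Z}$, and the measure $\begin{bmatrix}\mu^{(1)}&\mu^{(2)}\\ \overline{\mu^{(2)}}&\nu\end{bmatrix}$ is positive semidefinite-valued, where $\int_0^{2\pi} e^{in\theta}\mathrm{d}\nu(\theta)=\int_0^{2\pi} e^{-in\theta}\mathrm{d}\mu^{(1)}(\theta)$ for all $n\in\mathbb{Z}$. Its moments are $c_n=\int_0^{2\pi}e^{in\theta}\mathrm{d}\mu_i(\theta)\in\mathbb{H}$, $n\in\mathbb{Z}$ (one has $c_{-n}=\overline{c_n}$). It is a probability $q$-positive measure if $c_0=1$. It is non-trivial if for every $n\ge0$ the quaternionic Toeplitz matrix $T_n(c)=[c_{\ell-k}]_{k,\ell=0}^n$ (row $k$, column $\ell$) is positive definite, i.e. $\xi^*T_n(c)\xi>0$ for all nonzero $\xi\in\mathbb{H}^{n+1}$. Orthonormal polynomials. $\mathbb{H}[p]^L$ is the set of polynomials $\sum_k p^k\varphi_k$ and $\mathbb{H}[p]^R$ the set of polynomials $\sum_k\varphi_kp^k$, with $\varphi_k\in\mathbb{H}$. On $\mathbb{H}[p]^L$ put $\langle\varphi,\psi\rangle_R=\sum_{k,\ell}\overline{\psi_\ell}\,c_{k-\ell}\,\varphi_k$; on $\mathbb{H}[p]^R$ put $\langle\varphi,\psi\rangle_L=\sum_{k,\ell}\varphi_k\,c_{k-\ell}\,\overline{\psi_\ell}$. The right-orthonormal polynomials $(\psi_n^R)_{n\ge0}\subset\mathbb{H}[p]^L$ (coefficients on the right) and the left-orthonormal polynomials $(\psi_n^L)_{n\ge0}\subset\mathbb{H}[p]^R$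 (coefficients on the left) are obtained from $1,p,p^2,\dots$ by the Gram–Schmidt algorithm with respect to $\langle\cdot,\cdot\rangle_R$ and $\langle\cdot,\cdot\rangle_L$ respectively; thus $\psi_n^{R},\psi_n^L$ have degree $n$ and positive real leading coefficient. Reverse polynomials: for $\varphi(p)=\sum_{k=0}^np^k\varphi_k\in\mathbb{H}[p]^L$ of degree $n$, $\varphi^\#(p)=\overline{\varphi(1/\overline p)}\,p^n=\sum_k\overline{\varphi_k}\,p^{n-k}\in\mathbb{H}[p]^R$; for $\psi(p)=\sum_{k=0}^n\psi_kp^k\in\mathbb{H}[p]^R$ of degree $n$, $\psi^\#(p)=p^n\,\overline{\psi(1/\overline p)}=\sum_kp^{n-k}\,\overline{\psi_k}\in\mathbb{H}[p]^L$. Write $\psi_n^{L,\#}=(\psi_n^L)^\#$, $\psi_n^{R,\#}=(\psi_n^R)^\#$. Verblunsky coefficients. For power series with right coefficients the $\star$-product is $(\sum p^ka_k)\star(\sum p^kb_k)=\sum_np^n\sum_{k=0}^na_kb_{n-k}$, and $g^{-\star}$ is the $\star$-inverse. Let $F(p)=1+2\sum_{n\ge1}p^nc_{-n}$ for $|p|<1$ (so that $F(z)=\int_0^{2\pi}\frac{1+ze^{-i\theta}}{1-ze^{-i\theta}}\mathrm{d}\mu_i(\theta)$ for $z\in\mathbb{C}_i$, $|z|<1$), and let $f$ be the quaternionic Schur function with $F=(1+pf)\star(1-pf)^{-\star}$. The Verblunsky coefficients are given by the quaternionic Schur algorithm: $f_0=f$, $\gamma_n=f_n(0)$, $p\,f_{n+1}(p)=(f_n-\gamma_n)\star(1-\overline{\gamma_n}\star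 f_n)^{-\star}(p)$; they satisfy $|\gamma_n|<1$. *)

theory Defs
  imports
    "HOL-Analysis.Analysis"
    "HOL-Computational_Algebra.Polynomial"
    "HOL-Computational_Algebra.Formal_Power_Series"
begin

section \<open>Quaternions\<close>

datatype quat = Quat (qRe: real) (qIm1: real) (qIm2: real) (qIm3: real)

lemma quat_eq_iff:
  "x = y \<longleftrightarrow> qRe x = qRe y \<and> qIm1 x = qIm1 y \<and> qIm2 x = qIm2 y \<and> qIm3 x = qIm3 y"
  by (cases x; cases y) simp

instantiation quat :: ring_1
begin

definition "0 = Quat 0 0 0 0"
definition "1 = Quat 1 0 0 0"
definition "x + y = Quat (qRe x + qRe y) (qIm1 x + qIm1 y) (qIm2 x + qIm2 y) (qIm3 x + qIm3 y)"
definition "- x = Quat (- qRe x) (- qIm1 x) (- qIm2 x) (- qIm3 x)"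
definition "(x::quat) - y = x + (- y)"
definition "x * y = Quat
  (qRe x * qRe y - qIm1 x * qIm1 y - qIm2 x * qIm2 y - qIm3 x * qIm3 y)
  (qRe x * qIm1 y + qIm1 x * qRe y + qIm2 x * qIm3 y - qIm3 x * qIm2 y)
  (qRe x * qIm2 y - qIm1 x * qIm3 y + qIm2 x * qRe y + qIm3 x * qIm1 y)
  (qRe x * qIm3 y + qIm1 x * qIm2 y - qIm2 x * qIm1 y + qIm3 x * qRe y)"

instance
  by standard
    (simp_all add: zero_quat_def one_quat_def plus_quat_def uminus_quat_def minus_quat_def
      times_quat_def algebra_simps)

end

lemma quat_sel [simp]:
  "qRe 0 = 0" "qIm1 0 = 0" "qIm2 0 = 0" "qIm3 0 = 0"
  "qRe 1 = 1" "qIm1 1 = 0" "qIm2 1 = 0" "qIm3 1 = 0"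
  "qRe (x + y) = qRe x + qRe y" "qIm1 (x + y) = qIm1 x + qIm1 y"
  "qIm2 (x + y) = qIm2 x + qIm2 y" "qIm3 (x + y) = qIm3 x + qIm3 y"
  "qRe (- x) = - qRe x" "qIm1 (- x) = - qIm1 x" "qIm2 (- x) = - qIm2 x" "qIm3 (- x) = - qIm3 x"
  "qRe (x - y) = qRe x - qRe y" "qIm1 (x - y) = qIm1 x - qIm1 y"
  "qIm2 (x - y) = qIm2 x - qIm2 y" "qIm3 (x - y) = qIm3 x - qIm3 y"
  by (simp_all add: zero_quat_def one_quat_def plus_quat_def uminus_quat_def minus_quat_def)

lemma quat_sel_times:
  "qRe (x * y) = qRe x * qRe y - qIm1 x * qIm1 y - qIm2 x * qIm2 y - qIm3 x * qIm3 y"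
  "qIm1 (x * y) = qRe x * qIm1 y + qIm1 x * qRe y + qIm2 x * qIm3 y - qIm3 x * qIm2 y"
  "qIm2 (x * y) = qRe x * qIm2 y - qIm1 x * qIm3 y + qIm2 x * qRe y + qIm3 x * qIm1 y"
  "qIm3 (x * y) = qRe x * qIm3 y + qIm1 x * qIm2 y - qIm2 x * qIm1 y + qIm3 x * qRe y"
  by (simp_all add: times_quat_def)

instantiation quat :: real_inner
begin

definition "scaleR r x = Quat (r * qRe x) (r * qIm1 x) (r * qIm2 x) (r * qIm3 x)"
definition "inner x y = qRe x * qRe y + qIm1 x * qIm1 y + qIm2 x * qIm2 y + qIm3 x * qIm3 y"
definition "norm (x::quat) = sqrt (inner x x)"
definition "sgn (x::quat) = inverse (norm x) *\<^sub>R x"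
definition "dist (x::quat) y = norm (x - y)"
definition "(uniformity :: (quat \<times> quat) filter) = (INF e\<in>{0<..}. principal {(x, y). dist x y < e})"
definition "open (U :: quat set) \<longleftrightarrow> (\<forall>x\<in>U. eventually (\<lambda>(x', y). x' = x \<longrightarrow> y \<in> U) uniformity)"

instance
proof
  fix x y z :: quat and r s :: real
  show "inner x y = inner y x"
    by (simp add: inner_quat_def algebra_simps)
  show "inner (x + y) z = inner x z + inner y z"
    by (simp add: inner_quat_def algebra_simps)
  show "0 \<le> inner x x"
    by (simp add: inner_quat_def)
  show "inner x x = 0 \<longleftrightarrow> x = 0"
    by (auto simp add: inner_quat_def quat_eq_iff add_nonneg_eq_0_iff)
  show "norm x = sqrt (inner x x)"
    by (rule norm_quat_def)
  show "sgn x = inverse (norm x) *\<^sub>R x"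
    by (rule sgn_quat_def)
  show "dist x y = norm (x - y)"
    by (rule dist_quat_def)
  show "(uniformity :: (quat \<times> quat) filter) = (INF e\<in>{0<..}. principal {(x, y). dist x y < e})"
    by (rule uniformity_quat_def)
  fix U :: "quat set"
  show "open U \<longleftrightarrow> (\<forall>x\<in>U. eventually (\<lambda>(x', y). x' = x \<longrightarrow> y \<in> U) uniformity)"
    by (rule open_quat_def)
qed (simp_all add: quat_eq_iff scaleR_quat_def inner_quat_def algebra_simps)

end

lemma quat_sel_scaleR [simp]:
  "qRe (r *\<^sub>R x) = r * qRe x" "qIm1 (r *\<^sub>R x) = r * qIm1 x"
  "qIm2 (r *\<^sub>R x) = r * qIm2 x" "qIm3 (r *\<^sub>R x) = r * qIm3 x"
  by (simp_all add: scaleR_quat_def)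

definition qcnj :: "quat \<Rightarrow> quat"
  where "qcnj x = Quat (qRe x) (- qIm1 x) (- qIm2 x) (- qIm3 x)"

lemma quat_sel_qcnj [simp]:
  "qRe (qcnj x) = qRe x" "qIm1 (qcnj x) = - qIm1 x"
  "qIm2 (qcnj x) = - qIm2 x" "qIm3 (qcnj x) = - qIm3 x"
  by (simp_all add: qcnj_def)

instantiation quat :: real_normed_div_algebra
begin

definition "inverse x = qcnj x /\<^sub>R (norm x)\<^sup>2"
definition "(x::quat) div y = x * inverse y"

instance
proof
  fix x y :: quat and r :: real
  have sq: "(norm z)\<^sup>2 = (qRe z)\<^sup>2 + (qIm1 z)\<^sup>2 + (qIm2 z)\<^sup>2 + (qIm3 z)\<^sup>2" for z :: quat
    unfolding power2_norm_eq_inner by (simp add: inner_quat_def power2_eq_square)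
  show "r *\<^sub>R x * y = r *\<^sub>R (x * y)" "x * r *\<^sub>R y = r *\<^sub>R (x * y)"
    by (simp_all add: quat_eq_iff quat_sel_times algebra_simps)
  have "(norm (x * y))\<^sup>2 = (norm x * norm y)\<^sup>2"
    unfolding power_mult_distrib sq quat_sel_times by algebra
  then show "norm (x * y) = norm x * norm y"
    by (simp add: power2_eq_iff_nonneg)
  show "x div y = x * inverse y"
    by (rule divide_quat_def)
  show "inverse (0::quat) = 0"
    by (simp add: inverse_quat_def quat_eq_iff)
  assume "x \<noteq> 0"
  then have nz: "(norm x)\<^sup>2 \<noteq> 0"
    by simp
  have c: "qcnj x * x = (norm x)\<^sup>2 *\<^sub>R 1" "x * qcnj x = (norm x)\<^sup>2 *\<^sub>R 1"
    unfolding sq by (simp_all add: quat_eq_iff quat_sel_times power2_eq_square algebra_simps)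
  have "inverse x * x = inverse ((norm x)\<^sup>2) *\<^sub>R (qcnj x * x)"
    by (simp add: inverse_quat_def quat_eq_iff quat_sel_times algebra_simps)
  with nz show "inverse x * x = 1"
    by (simp add: c)
  have "x * inverse x = inverse ((norm x)\<^sup>2) *\<^sub>R (x * qcnj x)"
    by (simp add: inverse_quat_def quat_eq_iff quat_sel_times algebra_simps)
  with nz show "x * inverse x = 1"
    by (simp add: c)
qed

end

instantiation quat :: euclidean_space
begin

definition "Basis = {Quat 1 0 0 0, Quat 0 1 0 0, Quat 0 0 1 0, Quat 0 0 0 1}"

instance
proof
  fix u v x :: quat
  show "(Basis :: quat set) \<noteq> {}" "finite (Basis :: quat set)"
    by (simp_all add: Basis_quat_def)
  show "inner u v = (if u = v then 1 else 0)" if "u \<in> Basis" "v \<in> Basis"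
    using that unfolding Basis_quat_def by (elim insertE emptyE) (simp_all add: inner_quat_def)
  show "(\<forall>u\<in>Basis. inner x u = 0) \<longleftrightarrow> x = 0"
    unfolding quat_eq_iff by (simp add: Basis_quat_def inner_quat_def)
qed

end

section \<open>Slices\<close>

definition imag_sphere :: "quat set"
  where "imag_sphere = {q. qRe q = 0 \<and> norm q = 1}"

definition slice :: "quat \<Rightarrow> quat set"
  where "slice i = {of_real a + of_real b * i | a b. True}"

definition slice_circle :: "quat \<Rightarrow> quat set"
  where "slice_circle i = {u \<in> slice i. norm u = 1}"

definition circle_borel :: "quat \<Rightarrow> quat measure"
  where "circle_borel i = restrict_space borel (slice_circle i)"

section \<open>Vector-valued measures\<close>

text \<open>
  A vector-valued measure is a countably additive set function on \<open>sets M\<close>; its values on other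
  sets are irrelevant. \<open>M\<close> only carries the sigma-algebra, and its own measure plays no role.
\<close>

definition vector_measure :: "'a measure \<Rightarrow> ('a set \<Rightarrow> 'b::real_normed_vector) \<Rightarrow> bool"
  where "vector_measure M \<nu> \<longleftrightarrow> \<nu> {} = 0 \<and>
    (\<forall>A. range A \<subseteq> sets M \<longrightarrow> disjoint_family A \<longrightarrow> (\<lambda>n::nat. \<nu> (A n)) sums \<nu> (\<Union>n. A n))"

text \<open>
  The positive part of a signed measure in its Jordan decomposition,
  \<open>\<nu>\<^sup>+ A = sup {\<nu> B | B \<subseteq> A}\<close>. The truncation of negative numbers by \<^const>\<open>ennreal\<close> is harmless,
  since \<open>B = {}\<close> contributes \<open>0\<close>.
\<close>

definition positive_part :: "'a measure \<Rightarrow> ('a set \<Rightarrow> real) \<Rightarrow> 'a measure"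
  where "positive_part M \<nu> = measure_of (space M) (sets M)
    (\<lambda>A. SUP B\<in>{B \<in> sets M. B \<subseteq> A}. ennreal (\<nu> B))"

definition signed_integral ::
    "'a measure \<Rightarrow> ('a set \<Rightarrow> real) \<Rightarrow> ('a \<Rightarrow> 'b::{banach, second_countable_topology}) \<Rightarrow> 'b"
  where "signed_integral M \<nu> f =
    integral\<^sup>L (positive_part M \<nu>) f - integral\<^sup>L (positive_part M (\<lambda>A. - \<nu> A)) f"

text \<open>\<open>\<integral> f d\<nu>\<close> for a quaternion-valued measure; the integrand multiplies from the left.\<close>

definition quat_integral :: "quat measure \<Rightarrow> (quat set \<Rightarrow> quat) \<Rightarrow> (quat \<Rightarrow> quat) \<Rightarrow> quat"
  where "quat_integral M \<nu> f =
    signed_integral M (\<lambda>A. qRe (\<nu> A)) f +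
    signed_integral M (\<lambda>A. qIm1 (\<nu> A)) f * Quat 0 1 0 0 +
    signed_integral M (\<lambda>A. qIm2 (\<nu> A)) f * Quat 0 0 1 0 +
    signed_integral M (\<lambda>A. qIm3 (\<nu> A)) f * Quat 0 0 0 1"

text \<open>\<open>\<integral> e\<^sup>i\<^sup>n\<^sup>\<theta> d\<nu>(\<theta>)\<close>, written with the variable \<open>u = e\<^sup>i\<^sup>\<theta>\<close> on the circle.\<close>

definition moment :: "quat \<Rightarrow> (quat set \<Rightarrow> quat) \<Rightarrow> int \<Rightarrow> quat"
  where "moment i \<nu> n = quat_integral (circle_borel i) \<nu> (\<lambda>u. u powi n)"

definition slice_measure :: "quat \<Rightarrow> (quat set \<Rightarrow> quat) \<Rightarrow> bool"
  where "slice_measure i \<nu> \<longleftrightarrow>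
    vector_measure (circle_borel i) \<nu> \<and> (\<forall>A\<in>sets (circle_borel i). \<nu> A \<in> slice i)"

section \<open>Positivity\<close>

text \<open>\<open>\<xi>\<^sup>* A \<xi>\<close> for the \<open>n \<times> n\<close> matrix with entries \<open>A k l\<close>, \<open>k, l < n\<close>.\<close>

definition quat_form :: "nat \<Rightarrow> (nat \<Rightarrow> nat \<Rightarrow> quat) \<Rightarrow> (nat \<Rightarrow> quat) \<Rightarrow> quat"
  where "quat_form n A \<xi> = (\<Sum>k<n. \<Sum>l<n. qcnj (\<xi> k) * A k l * \<xi> l)"

definition quat_pos_def :: "nat \<Rightarrow> (nat \<Rightarrow> nat \<Rightarrow> quat) \<Rightarrow> bool"
  where "quat_pos_def n A \<longleftrightarrow>
    (\<forall>\<xi>. (\<exists>k<n. \<xi> k \<noteq> 0) \<longrightarrow> (\<exists>r>0. quat_form n A \<xi> = of_real r))"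

definition slice_pos_semidef :: "quat \<Rightarrow> nat \<Rightarrow> (nat \<Rightarrow> nat \<Rightarrow> quat) \<Rightarrow> bool"
  where "slice_pos_semidef i n A \<longleftrightarrow>
    (\<forall>\<xi>. (\<forall>k<n. \<xi> k \<in> slice i) \<longrightarrow> (\<exists>r\<ge>0. quat_form n A \<xi> = of_real r))"

definition matrix22 :: "quat \<Rightarrow> quat \<Rightarrow> quat \<Rightarrow> quat \<Rightarrow> nat \<Rightarrow> nat \<Rightarrow> quat"
  where "matrix22 a b c d k l =
    (if k = 0 then (if l = 0 then a else b) else (if l = 0 then c else d))"

definition q_positive :: "quat \<Rightarrow> quat \<Rightarrow> (quat set \<Rightarrow> quat) \<Rightarrow> bool"
  where "q_positive i j \<mu> \<longleftrightarrow> vector_measure (circle_borel i) \<mu> \<and>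
    (\<exists>\<mu>1 \<mu>2 \<nu>. slice_measure i \<mu>1 \<and> slice_measure i \<mu>2 \<and> slice_measure i \<nu> \<and>
      (\<forall>A\<in>sets (circle_borel i). \<mu> A = \<mu>1 A + \<mu>2 A * j) \<and>
      (\<forall>A\<in>sets (circle_borel i). \<exists>r\<ge>0. \<mu>1 A = of_real r) \<and>
      (\<forall>n. moment i \<mu>2 n = - moment i \<mu>2 (- n)) \<and>
      (\<forall>n. moment i \<nu> n = moment i \<mu>1 (- n)) \<and>
      (\<forall>A\<in>sets (circle_borel i).
        slice_pos_semidef i 2 (matrix22 (\<mu>1 A) (\<mu>2 A) (qcnj (\<mu>2 A)) (\<nu> A))))"

text \<open>The Toeplitz matrix \<open>T\<^sub>n(c)\<close> has \<open>n + 1\<close> rows and columns.\<close>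

definition nontrivial :: "(int \<Rightarrow> quat) \<Rightarrow> bool"
  where "nontrivial c \<longleftrightarrow> (\<forall>n. quat_pos_def (Suc n) (\<lambda>k l. c (int l - int k)))"

section \<open>Orthonormal polynomials\<close>

text \<open>
  Both \<open>\<H>[p]\<^sup>L\<close> and \<open>\<H>[p]\<^sup>R\<close> are represented by \<^typ>\<open>quat poly\<close>, that is, by finite coefficient
  sequences; they differ in the evaluation and in the side of the scalar multiplication. A suffix
  \<open>R\<close> belongs to the right-orthonormal polynomials, which lie in \<open>\<H>[p]\<^sup>L\<close>, and a suffix \<open>L\<close> to the
  left-orthonormal ones, which lie in \<open>\<H>[p]\<^sup>R\<close>.
\<close>

definition eval_right_coeffs :: "quat poly \<Rightarrow> quat \<Rightarrow> quat"
  where "eval_right_coeffs \<phi> p = (\<Sum>k\<le>degree \<phi>. p ^ k * coeff \<phi> k)"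

definition eval_left_coeffs :: "quat poly \<Rightarrow> quat \<Rightarrow> quat"
  where "eval_left_coeffs \<phi> p = (\<Sum>k\<le>degree \<phi>. coeff \<phi> k * p ^ k)"

definition scale_right :: "quat poly \<Rightarrow> quat \<Rightarrow> quat poly"
  where "scale_right \<phi> a = map_poly (\<lambda>x. x * a) \<phi>"

definition scale_left :: "quat \<Rightarrow> quat poly \<Rightarrow> quat poly"
  where "scale_left a \<phi> = map_poly (\<lambda>x. a * x) \<phi>"

definition ip_R :: "(int \<Rightarrow> quat) \<Rightarrow> quat poly \<Rightarrow> quat poly \<Rightarrow> quat"
  where "ip_R c \<phi> \<psi> = (\<Sum>k\<le>degree \<phi>. \<Sum>l\<le>degree \<psi>.
    qcnj (coeff \<psi> l) * c (int k - int l) * coeff \<phi> k)"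

definition ip_L :: "(int \<Rightarrow> quat) \<Rightarrow> quat poly \<Rightarrow> quat poly \<Rightarrow> quat"
  where "ip_L c \<phi> \<psi> = (\<Sum>k\<le>degree \<phi>. \<Sum>l\<le>degree \<psi>.
    coeff \<phi> k * c (int k - int l) * qcnj (coeff \<psi> l))"

definition normalize_R :: "(int \<Rightarrow> quat) \<Rightarrow> quat poly \<Rightarrow> quat poly"
  where "normalize_R c \<phi> = scale_right \<phi> (of_real (1 / sqrt (qRe (ip_R c \<phi> \<phi>))))"

definition normalize_L :: "(int \<Rightarrow> quat) \<Rightarrow> quat poly \<Rightarrow> quat poly"
  where "normalize_L c \<phi> = scale_left (of_real (1 / sqrt (qRe (ip_L c \<phi> \<phi>)))) \<phi>"

text \<open>The Gram--Schmidt algorithm applied to \<open>1, p, p\<^sup>2, \<dots>\<close>\<close>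

fun psi_R :: "(int \<Rightarrow> quat) \<Rightarrow> nat \<Rightarrow> quat poly"
  where "psi_R c n = normalize_R c
    (monom 1 n - (\<Sum>k<n. scale_right (psi_R c k) (ip_R c (monom 1 n) (psi_R c k))))"

fun psi_L :: "(int \<Rightarrow> quat) \<Rightarrow> nat \<Rightarrow> quat poly"
  where "psi_L c n = normalize_L c
    (monom 1 n - (\<Sum>k<n. scale_left (ip_L c (monom 1 n) (psi_L c k)) (psi_L c k)))"

declare psi_R.simps [simp del] psi_L.simps [simp del]

text \<open>
  \<open>\<phi>\<^sup>#\<close> with coefficients \<open>qcnj \<phi>\<^sub>n\<^sub>-\<^sub>k\<close>, where \<open>n = degree \<phi>\<close>. On coefficients the reversal is the same
  from \<open>\<H>[p]\<^sup>L\<close> to \<open>\<H>[p]\<^sup>R\<close> and from \<open>\<H>[p]\<^sup>R\<close> to \<open>\<H>[p]\<^sup>L\<close>, but the coefficients change sides.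
\<close>

definition reverse_poly :: "quat poly \<Rightarrow> quat poly"
  where "reverse_poly \<phi> = reflect_poly (map_poly qcnj \<phi>)"

section \<open>Verblunsky coefficients\<close>

text \<open>
  A power series \<open>\<Sum>n. p\<^sup>n * a\<^sub>n\<close> with right coefficients is represented by the formal power series
  of its coefficients. The \<open>\<star>\<close>-product is then the product of \<^typ>\<open>quat fps\<close>, the \<open>\<star>\<close>-inverse is
  \<^const>\<open>inverse\<close> (the series inverted below have nonzero constant coefficient), and
  the value at \<open>0\<close> is the coefficient with index \<open>0\<close>. A function on the unit ball has at most one
  such expansion.
\<close>

definition quat_schur :: "quat fps \<Rightarrow> bool"
  where "quat_schur f \<longleftrightarrow> (\<forall>p. norm p < 1 \<longrightarrow>
    summable (\<lambda>n. p ^ n * fps_nth f n) \<and> norm (\<Sum>n. p ^ n * fps_nth f n) \<le> 1)"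

definition caratheodory :: "(int \<Rightarrow> quat) \<Rightarrow> quat fps"
  where "caratheodory c = Abs_fps (\<lambda>n. if n = 0 then 1 else 2 * c (- int n))"

definition verblunsky_coeffs :: "(int \<Rightarrow> quat) \<Rightarrow> (nat \<Rightarrow> quat) \<Rightarrow> bool"
  where "verblunsky_coeffs c \<gamma> \<longleftrightarrow> (\<exists>f :: nat \<Rightarrow> quat fps.
    quat_schur (f 0) \<and>
    caratheodory c = (1 + fps_X * f 0) * inverse (1 - fps_X * f 0) \<and>
    (\<forall>n. \<gamma> n = fps_nth (f n) 0) \<and>
    (\<forall>n. fps_X * f (Suc n) =
      (f n - fps_const (\<gamma> n)) * inverse (1 - fps_const (qcnj (\<gamma> n)) * f n)))"

end

theory Submission
  imports Defs
begin

text \<open>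
  Positive definiteness of the Toeplitz matrices alone forces \<open>c\<^sub>-\<^sub>n = qcnj c\<^sub>n\<close>, after which the
  measure plays no role. Let \<open>P\<^sub>n\<close>, \<open>Q\<^sub>n\<close> be the polynomials with left coefficients generated by the
  Szego recursion \<open>P\<^sub>n\<^sub>+\<^sub>1 = P\<^sub>n p - qcnj \<gamma>\<^sub>n Q\<^sub>n\<close>, \<open>Q\<^sub>n\<^sub>+\<^sub>1 = Q\<^sub>n - \<gamma>\<^sub>n P\<^sub>n p\<close> from \<open>P\<^sub>0 = Q\<^sub>0 = 1\<close>, where the
  \<open>\<gamma>\<^sub>n\<close> come from the Schur algorithm. Multiplied by the Laurent series \<open>\<Sum> p\<^sup>m c\<^sub>-\<^sub>m\<close>, the polynomial
  \<open>P\<^sub>n\<close> gives a series whose coefficients at \<open>p\<^sup>m\<close> are its moments \<open>\<langle>P\<^sub>n, p\<^sup>m\<rangle>\<^sub>L\<close>. The moments of \<open>P\<^sub>n\<close> from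
  \<open>m = n\<close> on and those of \<open>Q\<^sub>n\<close> from \<open>m = n + 1\<close> on form power series \<open>S\<^sub>n\<close> and \<open>N\<^sub>n\<close>, and the Schur
  algorithm says exactly \<open>f\<^sub>n \<star> S\<^sub>n = N\<^sub>n\<close>. Comparing constant coefficients shows that the next moment
  of \<open>Q\<^sub>n\<^sub>+\<^sub>1\<close> vanishes, and the symmetry of the inner product gives the one of \<open>P\<^sub>n\<^sub>+\<^sub>1\<close>. Hence \<open>P\<^sub>n\<close> and
  the reversal of \<open>Q\<^sub>n\<close> are the monic left and right orthogonal polynomials, with common squared
  norm \<open>\<Prod>\<^sub>k\<^sub><\<^sub>n (1 - |\<gamma>\<^sub>k|\<^sup>2)\<close>, and the theorem is the Szego recursion after normalization.
\<close>

section \<open>Moments and inner products\<close>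

lemma quat_mult_of_real [simp]: "q * of_real x = x *\<^sub>R (q::quat)" "of_real x * q = x *\<^sub>R q"
  by (simp_all add: of_real_def)

lemma qRe_of_real [simp]: "qRe (of_real x) = x"
  by (simp add: of_real_def)

lemma qcnj_simps [simp]:
  "qcnj 0 = 0" "qcnj 1 = 1" "qcnj (qcnj x) = x" "qcnj (of_real a) = of_real a"
  "qcnj (- x) = - qcnj x" "qcnj (x + y) = qcnj x + qcnj y" "qcnj (x - y) = qcnj x - qcnj y"
  "qcnj (a *\<^sub>R x) = a *\<^sub>R qcnj x" "qcnj (x * y) = qcnj y * qcnj x"
  "qcnj x = 0 \<longleftrightarrow> x = 0"
  by (simp_all add: quat_eq_iff quat_sel_times of_real_def algebra_simps)

lemma qcnj_sum: "qcnj (sum f A) = (\<Sum>x\<in>A. qcnj (f x))"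
  by (induction A rule: infinite_finite_induct) simp_all

lemma qcnj_mult_self: "qcnj x * x = of_real ((norm x)\<^sup>2)" "x * qcnj x = of_real ((norm x)\<^sup>2)"
  unfolding power2_norm_eq_inner
  by (simp_all add: quat_eq_iff quat_sel_times of_real_def inner_quat_def)

lemma sum_upto_degree_eq:
  fixes g :: "nat \<Rightarrow> 'a::zero \<Rightarrow> 'b::comm_monoid_add"
  assumes "\<And>k. g k 0 = 0" and "degree \<phi> \<le> N"
  shows "(\<Sum>k\<le>degree \<phi>. g k (coeff \<phi> k)) = (\<Sum>k\<le>N. g k (coeff \<phi> k))"
  using assms by (intro sum.mono_neutral_left) (auto simp: coeff_eq_0)

lemma coeff_scale_left [simp]: "coeff (scale_left a \<phi>) k = a * coeff \<phi> k"
  by (simp add: scale_left_def coeff_map_poly)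

lemma coeff_scale_right [simp]: "coeff (scale_right \<phi> a) k = coeff \<phi> k * a"
  by (simp add: scale_right_def coeff_map_poly)

lemma degree_scale_left: "a \<noteq> 0 \<Longrightarrow> degree (scale_left a \<phi>) = degree \<phi>"
  by (simp add: scale_left_def degree_map_poly)

lemma degree_scale_left_le: "degree (scale_left a \<phi>) \<le> degree \<phi>"
  by (intro degree_le) (simp add: coeff_eq_0)

text \<open>For \<open>m \<ge> 0\<close> this is the inner product with the monomial of degree
  \<open>m\<close>; an integer \<open>m\<close> permits the shift caused by a factor p.\<close>

definition left_moment :: "(int \<Rightarrow> quat) \<Rightarrow> quat poly \<Rightarrow> int \<Rightarrow> quat"
  where "left_moment c \<phi> m = (\<Sum>k\<le>degree \<phi>. coeff \<phi> k * c (int k - m))"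

lemma left_moment_upto:
  "degree \<phi> \<le> N \<Longrightarrow> left_moment c \<phi> m = (\<Sum>k\<le>N. coeff \<phi> k * c (int k - m))"
  unfolding left_moment_def by (rule sum_upto_degree_eq) simp

lemma left_moment_add:
  "left_moment c (\<phi> + \<psi>) m = left_moment c \<phi> m + left_moment c \<psi> m"
proof -
  let ?N = "max (degree \<phi>) (degree \<psi>)"
  have "degree (\<phi> + \<psi>) \<le> ?N"
    by (rule degree_add_le_max)
  then show ?thesis
    by (simp add: left_moment_upto[where N = ?N] sum.distrib distrib_right)
qed

lemma left_moment_scale: "left_moment c (scale_left a \<phi>) m = a * left_moment c \<phi> m"
  by (subst left_moment_upto[OF degree_scale_left_le])
    (simp add: left_moment_def sum_distrib_left mult.assoc)

lemma left_moment_diff: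
  "left_moment c (\<phi> - \<psi>) m = left_moment c \<phi> m - left_moment c \<psi> m"
  using left_moment_add[of c "\<phi> - \<psi>" \<psi> m] by simp

lemma left_moment_const [simp]: "left_moment c [:a:] m = a * c (- m)"
  by (simp add: left_moment_def)

lemma left_moment_pCons_0: "left_moment c (pCons 0 \<phi>) m = left_moment c \<phi> (m - 1)"
proof -
  have "left_moment c (pCons 0 \<phi>) m = (\<Sum>k\<le>Suc (degree \<phi>). coeff (pCons 0 \<phi>) k * c (int k - m))"
    by (rule left_moment_upto) (simp add: degree_pCons_le)
  then show ?thesis
    unfolding sum.atMost_Suc_shift by (simp add: left_moment_def algebra_simps)
qed

lemma ip_L_eq_left_moments:
  "degree \<psi> \<le> N \<Longrightarrow> ip_L c \<phi> \<psi> = (\<Sum>l\<le>N. left_moment c \<phi> (int l) * qcnj (coeff \<psi> l))"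
proof -
  assume N: "degree \<psi> \<le> N"
  have "ip_L c \<phi> \<psi> = (\<Sum>l\<le>degree \<psi>. left_moment c \<phi> (int l) * qcnj (coeff \<psi> l))"
    unfolding ip_L_def left_moment_def by (subst sum.swap) (simp add: sum_distrib_right)
  also have "\<dots> = (\<Sum>l\<le>N. left_moment c \<phi> (int l) * qcnj (coeff \<psi> l))"
    using N by (intro sum_upto_degree_eq) simp_all
  finally show ?thesis .
qed

lemma ip_L_add_left: "ip_L c (\<phi> + \<psi>) \<eta> = ip_L c \<phi> \<eta> + ip_L c \<psi> \<eta>"
  by (simp add: ip_L_eq_left_moments[OF order_refl] left_moment_add distrib_right sum.distrib)

lemma ip_L_diff_left: "ip_L c (\<phi> - \<psi>) \<eta> = ip_L c \<phi> \<eta> - ip_L c \<psi> \<eta>"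
  by (simp add: ip_L_eq_left_moments[OF order_refl] left_moment_diff left_diff_distrib sum_subtractf)

lemma ip_L_scale_left: "ip_L c (scale_left a \<phi>) \<eta> = a * ip_L c \<phi> \<eta>"
  by (simp add: ip_L_eq_left_moments[OF order_refl] left_moment_scale sum_distrib_left mult.assoc)

lemma ip_L_sum_left: "ip_L c (sum f A) \<eta> = (\<Sum>x\<in>A. ip_L c (f x) \<eta>)"
proof -
  have "ip_L c 0 \<eta> = 0"
    by (simp add: ip_L_def)
  then show ?thesis
    by (induction A rule: infinite_finite_induct) (simp_all add: ip_L_add_left)
qed

lemma ip_L_scale_right: "ip_L c \<phi> (scale_left a \<eta>) = ip_L c \<phi> \<eta> * qcnj a"
  by (subst ip_L_eq_left_moments[OF degree_scale_left_le])
    (simp add: ip_L_eq_left_moments[OF order_refl] sum_distrib_right mult.assoc)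

section \<open>Hermitian symmetry of the moments\<close>

definition hermitian :: "(int \<Rightarrow> quat) \<Rightarrow> bool"
  where "hermitian c \<longleftrightarrow> (\<forall>n. c (- n) = qcnj (c n))"

lemma hermitian_diff: "hermitian c \<Longrightarrow> qcnj (c (k - l)) = c (l - k)"
  by (metis hermitian_def minus_diff_eq)

lemma qcnj_ip_L: "hermitian c \<Longrightarrow> qcnj (ip_L c \<phi> \<psi>) = ip_L c \<psi> \<phi>"
  unfolding ip_L_def by (subst sum.swap) (simp add: qcnj_sum mult.assoc hermitian_diff)

text \<open>Conjugation reverses products, so the coefficients change sides and the moments are
  reflected.\<close>

lemma qcnj_ip_R:
  assumes "hermitian c"
  shows "qcnj (ip_R c \<phi> \<psi>) = ip_L (\<lambda>n. c (- n)) (map_poly qcnj \<phi>) (map_poly qcnj \<psi>)"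
  using assms unfolding ip_R_def ip_L_def
  by (simp add: qcnj_sum mult.assoc hermitian_diff degree_map_poly coeff_map_poly)

text \<open>A form with only real values has a Hermitian matrix; vectors supported on the indices
  \<open>0\<close> and \<open>n\<close> detect this.\<close>

lemma hermitian_if_nontrivial:
  assumes "nontrivial c" and "c 0 = 1"
  shows "hermitian c"
proof -
  have pos: "c (- int n) = qcnj (c (int n))" for n
  proof (cases "n = 0")
    case False
    have real: "\<exists>r. 1 + c (int n) * b + qcnj b * c (- int n) + qcnj b * b = of_real r" for b
    proof -
      define \<xi> where "\<xi> k = (if k = 0 then 1 else if k = n then b else 0)" for k
      have "\<exists>k<Suc n. \<xi> k \<noteq> 0"
        by (rule exI[of _ 0]) (simp add: \<xi>_def)
      then have "\<exists>r>0. quat_form (Suc n) (\<lambda>k l. c (int l - int k)) \<xi> = of_real r"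
        using assms(1) unfolding nontrivial_def quat_pos_def_def by simp
      moreover have "quat_form (Suc n) (\<lambda>k l. c (int l - int k)) \<xi>
          = (\<Sum>k\<in>{0,n}. \<Sum>l\<in>{0,n}. qcnj (\<xi> k) * c (int l - int k) * \<xi> l)"
        unfolding quat_form_def
        by (intro sum.mono_neutral_cong_right) (auto simp: \<xi>_def intro!: sum.mono_neutral_right)
      ultimately show ?thesis
        using False by (auto simp: \<xi>_def assms(2) add.assoc)
    qed
    \<comment> \<open>\<open>b = 1\<close> makes the imaginary parts of the two moments opposite;
      the first imaginary unit makes their real parts equal.\<close>
    from real[of 1] real[of "Quat 0 1 0 0"] show ?thesis
      by (auto simp: quat_eq_iff quat_sel_times of_real_def)
  qed (simp add: assms(2))
  show ?thesis
    unfolding hermitian_def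
  proof
    fix m :: int
    show "c (- m) = qcnj (c m)"
      using pos[of "nat m"] pos[of "nat (- m)"] by (cases "m \<ge> 0") simp_all
  qed
qed

section \<open>Monic orthogonal polynomials\<close>

locale monic_orthogonal =
  fixes c :: "int \<Rightarrow> quat" and P :: "nat \<Rightarrow> quat poly" and h :: "nat \<Rightarrow> real"
  assumes herm: "hermitian c"
    and degree_P: "degree (P n) = n"
    and monic: "coeff (P n) n = 1"
    and orth: "m < n \<Longrightarrow> left_moment c (P n) (int m) = 0"
    and moment_P: "left_moment c (P n) (int n) = of_real (h n)"
    and h_pos: "h n > 0"
begin

text \<open>Moments below the degree vanish, so at most the leading coefficient contributes;
  symmetry covers \<open>k < l\<close>.\<close>

lemma ip_L_P: "ip_L c (P k) (P l) = (if k = l then of_real (h k) else 0)"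
proof -
  have less: "ip_L c (P k) (P l) = 0" if "l < k" for k l
    using that by (simp add: ip_L_eq_left_moments[where N = l] degree_P orth)
  consider "k = l" | "l < k" | "k < l"
    by linarith
  then show ?thesis
  proof cases
    case 1
    then have "ip_L c (P k) (P l) = (\<Sum>m\<le>k. if m = k then of_real (h k) else 0)"
      unfolding ip_L_eq_left_moments[where N = k, OF eq_refl[OF degree_P]] 1[symmetric]
      by (intro sum.cong) (auto simp: orth moment_P monic)
    with 1 show ?thesis
      by simp
  next
    case 3
    then show ?thesis
      using less[of k l] qcnj_ip_L[OF herm, of "P l" "P k"] by simp
  qed (simp add: less)
qed

text \<open>The monic \<open>P n\<close> cancels the coefficient at \<open>n\<close>, which lowers
  the bound.\<close>

lemma in_span_P:
  "\<forall>k\<ge>n. coeff \<phi> k = 0 \<Longrightarrow> \<exists>a. \<phi> = (\<Sum>k<n. scale_left (a k) (P k))"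
proof (induction n arbitrary: \<phi>)
  case 0
  then show ?case
    by (simp add: poly_eq_iff)
next
  case (Suc n)
  let ?\<psi> = "\<phi> - scale_left (coeff \<phi> n) (P n)"
  have "coeff ?\<psi> k = 0" if "k \<ge> n" for k
  proof (cases "k = n")
    case False
    with that Suc.prems show ?thesis
      by (simp add: coeff_eq_0 degree_P)
  qed (simp add: monic)
  then obtain a where a: "?\<psi> = (\<Sum>k<n. scale_left (a k) (P k))"
    using Suc.IH by blast
  have "\<phi> = (\<Sum>k<Suc n. scale_left ((a(n := coeff \<phi> n)) k) (P k))"
    using a by (simp add: algebra_simps)
  then show ?case
    by blast
qed

lemma Fourier_expansion:
  assumes "\<forall>k\<ge>n. coeff \<phi> k = 0"
  shows "\<phi> = (\<Sum>k<n. scale_left ((1 / h k) *\<^sub>R ip_L c \<phi> (P k)) (P k))"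
proof -
  obtain a where a: "\<phi> = (\<Sum>k<n. scale_left (a k) (P k))"
    using in_span_P[OF assms] by blast
  have "ip_L c \<phi> (P l) = h l *\<^sub>R a l" if "l < n" for l
  proof -
    have "ip_L c \<phi> (P l) = (\<Sum>k<n. if k = l then h l *\<^sub>R a l else 0)"
      by (subst a, unfold ip_L_sum_left, intro sum.cong) (auto simp: ip_L_scale_left ip_L_P)
    with that show ?thesis
      by simp
  qed
  moreover have "h k \<noteq> 0" for k
    using h_pos[of k] by simp
  ultimately have "(\<Sum>k<n. scale_left (a k) (P k))
      = (\<Sum>k<n. scale_left ((1 / h k) *\<^sub>R ip_L c \<phi> (P k)) (P k))"
    by (intro sum.cong) simp_all
  with a show ?thesis
    by simp
qed

text \<open>\<open>monom 1 n - P n\<close> has no terms from degree \<open>n\<close> on, and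
  \<open>P n\<close> is orthogonal to the earlier \<open>P k\<close>, so its Fourier expansion is
  the Gram--Schmidt correction.\<close>

lemma psi_L_eq: "psi_L c n = scale_left (of_real (1 / sqrt (h n))) (P n)"
proof (induction n rule: less_induct)
  case (less n)
  let ?\<phi> = "monom 1 n :: quat poly"
  have "\<forall>k\<ge>n. coeff (?\<phi> - P n) k = 0"
    by (auto simp: monic coeff_eq_0 degree_P le_less)
  then have "?\<phi> - P n = (\<Sum>k<n. scale_left ((1 / h k) *\<^sub>R ip_L c (?\<phi> - P n) (P k)) (P k))"
    by (rule Fourier_expansion)
  also have "\<dots> = (\<Sum>k<n. scale_left (ip_L c ?\<phi> (psi_L c k)) (psi_L c k))"
  proof (intro sum.cong refl poly_eqI)
    fix k l assume k: "k \<in> {..<n}"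
    \<comment> \<open>The two normalizing factors of \<open>psi_L c k\<close> supply the Fourier
      weight \<open>1 / h k\<close>.\<close>
    define s where "s = 1 / sqrt (h k)"
    have "psi_L c k = scale_left (of_real s) (P k)" "s * s = 1 / h k"
      using k h_pos[of k] less.IH by (simp_all add: s_def)
    with k show "coeff (scale_left ((1 / h k) *\<^sub>R ip_L c (?\<phi> - P n) (P k)) (P k)) l
        = coeff (scale_left (ip_L c ?\<phi> (psi_L c k)) (psi_L c k)) l"
      by (simp add: ip_L_diff_left ip_L_P ip_L_scale_right)
  qed
  finally have "?\<phi> - (\<Sum>k<n. scale_left (ip_L c ?\<phi> (psi_L c k)) (psi_L c k)) = P n"
    by (simp add: algebra_simps)
  then show ?case
    unfolding psi_L.simps[of c n] by (simp add: normalize_L_def ip_L_P)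
qed

end

section \<open>Right polynomials through conjugation and reversal\<close>

lemma map_poly_qcnj_sum: "map_poly qcnj (sum f A) = (\<Sum>x\<in>A. map_poly qcnj (f x))"
  by (simp add: poly_eq_iff coeff_map_poly coeff_sum qcnj_sum)

text \<open>Conjugating coefficients swaps the side of the scalars in every Gram--Schmidt step, so
  the left theory also covers the right polynomials.\<close>

lemma psi_R_eq_psi_L:
  assumes "hermitian c"
  shows "psi_R c n = map_poly qcnj (psi_L (\<lambda>n. c (- n)) n)"
proof (induction n rule: less_induct)
  case (less n)
  let ?c = "\<lambda>n. c (- n)"
  have qcnj_ip: "ip_R c \<phi> \<psi> = qcnj (ip_L ?c (map_poly qcnj \<phi>) (map_poly qcnj \<psi>))" for \<phi> \<psi>
    using qcnj_ip_R[OF assms] by (metis qcnj_simps(3))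
  have invol: "map_poly qcnj (map_poly qcnj \<phi>) = \<phi>" for \<phi>
    by (simp add: poly_eq_iff coeff_map_poly)
  have scale: "scale_right (map_poly qcnj \<phi>) (qcnj a) = map_poly qcnj (scale_left a \<phi>)" for \<phi> a
    by (simp add: poly_eq_iff coeff_map_poly)
  have diff: "map_poly qcnj (\<phi> - \<psi>) = map_poly qcnj \<phi> - map_poly qcnj \<psi>" for \<phi> \<psi>
    by (simp add: poly_eq_iff coeff_map_poly)
  have monom: "map_poly qcnj (monom 1 n) = monom 1 n"
    by (simp add: poly_eq_iff coeff_map_poly)
  have norm: "normalize_R c (map_poly qcnj \<phi>) = map_poly qcnj (normalize_L ?c \<phi>)" for \<phi>
    unfolding normalize_R_def normalize_L_def
    by (simp add: qcnj_ip invol scale[symmetric] del: of_real_divide)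
  show ?case
    unfolding psi_R.simps[of c n] psi_L.simps[of ?c n] norm[symmetric] diff monom map_poly_qcnj_sum
    by (simp add: less.IH qcnj_ip invol scale monom)
qed

text \<open>The index \<open>n\<close> is explicit because \<open>szego_Q \<gamma> n\<close> may
  have smaller degree.\<close>

definition reverse_at :: "nat \<Rightarrow> quat poly \<Rightarrow> quat poly"
  where "reverse_at n \<phi> = Poly (map (\<lambda>k. coeff \<phi> (n - k)) [0..<Suc n])"

lemma coeff_reverse_at: "coeff (reverse_at n \<phi>) k = (if k \<le> n then coeff \<phi> (n - k) else 0)"
  by (simp add: reverse_at_def nth_default_def del: upt_Suc)

lemma degree_reverse_at_le: "degree (reverse_at n \<phi>) \<le> n"
  by (intro degree_le) (simp add: coeff_reverse_at)

text \<open>Moments at \<open>1, ..., n\<close> become moments at \<open>0, ..., n - 1\<close>, so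
  the orthogonality of \<open>szego_Q\<close> becomes that of a monic polynomial.\<close>

lemma left_moment_reverse_at:
  assumes "degree \<phi> \<le> n"
  shows "left_moment (\<lambda>n. c (- n)) (reverse_at n \<phi>) m = left_moment c \<phi> (int n - m)"
  unfolding left_moment_upto[OF degree_reverse_at_le] left_moment_upto[OF assms]
  by (rule sum.reindex_bij_witness[of _ "\<lambda>k. n - k" "\<lambda>k. n - k"])
    (auto simp: coeff_reverse_at algebra_simps)

text \<open>Substituting \<open>\<xi>\<^sub>k = qcnj \<phi>\<^sub>n\<^sub>-\<^sub>k\<close> compensates for the transposed indices in \<^const>\<open>ip_L\<close>.\<close>

lemma ip_L_self_pos:
  assumes "nontrivial c" and "degree \<phi> = n" and "coeff \<phi> n \<noteq> 0"
  shows "\<exists>r>0. ip_L c \<phi> \<phi> = of_real r"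
proof -
  define \<xi> where "\<xi> k = qcnj (coeff \<phi> (n - k))" for k
  have "ip_L c \<phi> \<phi> = quat_form (Suc n) (\<lambda>k l. c (int l - int k)) \<xi>"
  proof -
    have rev: "(\<Sum>k\<le>n. g k) = (\<Sum>k\<le>n. g (n - k))" for g :: "nat \<Rightarrow> quat"
      using sum.nat_diff_reindex[of g "Suc n"] by (simp add: lessThan_Suc_atMost)
    show ?thesis
      unfolding quat_form_def ip_L_def assms(2) lessThan_Suc_atMost
      by (subst rev, subst (2) rev, intro sum.cong) (simp_all add: \<xi>_def)
  qed
  moreover have "\<xi> 0 \<noteq> 0"
    using assms(3) by (simp add: \<xi>_def)
  then have "\<exists>k<Suc n. \<xi> k \<noteq> 0"
    by blast
  ultimately show ?thesis
    using assms(1) unfolding nontrivial_def quat_pos_def_def by simp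
qed

section \<open>Szego recursion and Schur algorithm\<close>

fun szego_P :: "(nat \<Rightarrow> quat) \<Rightarrow> nat \<Rightarrow> quat poly"
  and szego_Q :: "(nat \<Rightarrow> quat) \<Rightarrow> nat \<Rightarrow> quat poly"
  where "szego_P \<gamma> 0 = [:1:]"
  | "szego_Q \<gamma> 0 = [:1:]"
  | "szego_P \<gamma> (Suc n) = pCons 0 (szego_P \<gamma> n) - scale_left (qcnj (\<gamma> n)) (szego_Q \<gamma> n)"
  | "szego_Q \<gamma> (Suc n) = szego_Q \<gamma> n - scale_left (\<gamma> n) (pCons 0 (szego_P \<gamma> n))"

lemma szego_degree:
  "degree (szego_P \<gamma> n) \<le> n" "coeff (szego_P \<gamma> n) n = 1"
  "degree (szego_Q \<gamma> n) \<le> n" "coeff (szego_Q \<gamma> n) 0 = 1"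
proof (induction n)
  case (Suc n)
  have pCons: "degree (pCons 0 (szego_P \<gamma> n)) \<le> Suc n"
    using Suc degree_pCons_le[of 0 "szego_P \<gamma> n"] by linarith
  case 1
  show ?case
    using Suc pCons degree_scale_left_le[of "qcnj (\<gamma> n)" "szego_Q \<gamma> n"]
    by (auto intro!: degree_diff_le)
  case 2
  show ?case
    using Suc by (simp add: coeff_eq_0)
  case 3
  show ?case
    using Suc pCons degree_scale_left_le[of "\<gamma> n" "pCons 0 (szego_P \<gamma> n)"]
    by (auto intro!: degree_diff_le simp del: degree_pCons_eq_if)
  case 4
  show ?case
    using Suc by simp
qed simp_all

lemma degree_szego_P: "degree (szego_P \<gamma> n) = n"
  using szego_degree[of \<gamma> n] by (metis le_antisym le_degree zero_neq_one)

definition residual_P :: "(int \<Rightarrow> quat) \<Rightarrow> (nat \<Rightarrow> quat) \<Rightarrow> nat \<Rightarrow> quat fps"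
  where "residual_P c \<gamma> n = Abs_fps (\<lambda>k. left_moment c (szego_P \<gamma> n) (int n + int k))"

definition residual_Q :: "(int \<Rightarrow> quat) \<Rightarrow> (nat \<Rightarrow> quat) \<Rightarrow> nat \<Rightarrow> quat fps"
  where "residual_Q c \<gamma> n = Abs_fps (\<lambda>k. left_moment c (szego_Q \<gamma> n) (int (Suc n) + int k))"

lemma residual_P_Suc:
  "residual_P c \<gamma> (Suc n) = residual_P c \<gamma> n - fps_const (qcnj (\<gamma> n)) * residual_Q c \<gamma> n"
  by (simp add: fps_eq_iff residual_P_def residual_Q_def left_moment_diff left_moment_scale
      left_moment_pCons_0)

text \<open>The hypothesis kills the constant coefficient of the right side, so \<open>fps_X\<close>
  can be split off.\<close>

lemma residual_Q_Suc:
  assumes "left_moment c (szego_Q \<gamma> n) (int (Suc n)) = \<gamma> n * left_moment c (szego_P \<gamma> n) (int n)"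
  shows "fps_X * residual_Q c \<gamma> (Suc n) = residual_Q c \<gamma> n - fps_const (\<gamma> n) * residual_P c \<gamma> n"
proof (rule fps_ext)
  fix k
  show "fps_nth (fps_X * residual_Q c \<gamma> (Suc n)) k
      = fps_nth (residual_Q c \<gamma> n - fps_const (\<gamma> n) * residual_P c \<gamma> n) k"
    using assms
    by (cases k) (simp_all add: residual_P_def residual_Q_def left_moment_diff left_moment_scale
        left_moment_pCons_0 algebra_simps)
qed

text \<open>
  Both sides are \<open>\<langle>p P\<^sub>n, Q\<^sub>n\<rangle>\<close>: \<open>p P\<^sub>n\<close> is orthogonal to \<open>p, \<dots>, p\<^sup>n\<close> and \<open>Q\<^sub>n\<close> has constant
  coefficient \<open>1\<close>, while \<open>Q\<^sub>n\<close> is orthogonal to \<open>p, \<dots>, p\<^sup>n\<close> and \<open>p P\<^sub>n\<close> is monic.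
\<close>

lemma szego_moment_sym:
  assumes "hermitian c"
    and P: "\<And>m. m < n \<Longrightarrow> left_moment c (szego_P \<gamma> n) (int m) = 0"
    and Q: "\<And>m. 0 < m \<Longrightarrow> m \<le> n \<Longrightarrow> left_moment c (szego_Q \<gamma> n) (int m) = 0"
  shows "left_moment c (szego_P \<gamma> n) (- 1) = qcnj (left_moment c (szego_Q \<gamma> n) (int (Suc n)))"
proof -
  let ?P = "pCons 0 (szego_P \<gamma> n)" and ?Q = "szego_Q \<gamma> n"
  have "ip_L c ?P ?Q = (\<Sum>l\<le>n. if l = 0 then left_moment c (szego_P \<gamma> n) (- 1) else 0)"
    unfolding ip_L_eq_left_moments[OF szego_degree(3)]
  proof (intro sum.cong refl)
    fix l assume "l \<in> {..n}"
    then show "left_moment c ?P (int l) * qcnj (coeff ?Q l)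
        = (if l = 0 then left_moment c (szego_P \<gamma> n) (- 1) else 0)"
      using P[of "l - 1"] by (cases l) (auto simp: left_moment_pCons_0 szego_degree)
  qed
  then have 1: "ip_L c ?P ?Q = left_moment c (szego_P \<gamma> n) (- 1)"
    by simp
  have "degree ?P \<le> Suc n"
    by (metis degree_pCons_le degree_szego_P)
  then have "ip_L c ?Q ?P
      = (\<Sum>l\<le>Suc n. if l = Suc n then left_moment c ?Q (int (Suc n)) else 0)"
    unfolding ip_L_eq_left_moments[OF \<open>degree ?P \<le> Suc n\<close>]
  proof (intro sum.cong refl)
    fix l assume "l \<in> {..Suc n}"
    then show "left_moment c ?Q (int l) * qcnj (coeff ?P l)
        = (if l = Suc n then left_moment c ?Q (int (Suc n)) else 0)"
      using Q[of l] szego_degree(2)[of \<gamma> n] by (cases "l = 0") auto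
  qed
  then have 2: "ip_L c ?Q ?P = left_moment c ?Q (int (Suc n))"
    by simp
  show ?thesis
    using qcnj_ip_L[OF assms(1), of ?Q ?P] by (simp add: 1 2)
qed

definition szego_norm :: "(nat \<Rightarrow> quat) \<Rightarrow> nat \<Rightarrow> real"
  where "szego_norm \<gamma> n = (\<Prod>k<n. 1 - (norm (\<gamma> k))\<^sup>2)"

text \<open>With \<open>G\<close> the residual of the constant \<open>1\<close> and \<open>u\<close>
  the star-inverse of \<open>1 - fps_X * f\<close>, the series is both \<open>2 G - 1\<close> and
  \<open>2 u - 1\<close>; hence \<open>G = u\<close>.\<close>

lemma caratheodory_residual:
  assumes "c 0 = 1" and car: "caratheodory c = (1 + fps_X * f) * inverse (1 - fps_X * f)"
  shows "f * residual_P c \<gamma> 0 = residual_Q c \<gamma> 0"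
proof -
  let ?G = "residual_P c \<gamma> 0" and ?u = "inverse (1 - fps_X * f)"
  have u: "(1 - fps_X * f) * ?u = 1"
    by (rule inverse_mult_eq_1') simp
  have "caratheodory c = (1 + 1 - (1 - fps_X * f)) * ?u"
    using car by simp
  also have "\<dots> = ?u + ?u - (1 - fps_X * f) * ?u"
    by (simp only: left_diff_distrib distrib_right mult_1)
  also have "\<dots> = ?u + ?u - 1"
    by (simp only: u)
  finally have "caratheodory c = ?u + ?u - 1" .
  moreover have "caratheodory c = ?G + ?G - 1"
    using assms(1)
    by (simp add: fps_eq_iff caratheodory_def residual_P_def mult_2)
  ultimately have "?G + ?G = ?u + ?u"
    by simp
  then have "?G = ?u"
    by (simp add: fps_eq_iff quat_eq_iff)
  with u have "?G = 1 + fps_X * (f * ?G)"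
    by (simp add: algebra_simps)
  \<comment> \<open>Removing the constant term and one factor \<open>fps_X\<close> from
    \<open>?G\<close> leaves the residual of \<open>szego_Q \<gamma> 0\<close>.\<close>
  then have "fps_nth ?G (Suc k) = fps_nth (1 + fps_X * (f * ?G)) (Suc k)" for k
    by simp
  then show ?thesis
    by (intro fps_ext) (simp add: residual_P_def residual_Q_def)
qed

text \<open>
  The induction carries \<open>f\<^sub>n = (residual of Q\<^sub>n) (residual of P\<^sub>n)\<^sup>-\<^sup>\<star>\<close>, whose constant coefficient
  identifies \<open>\<gamma>\<^sub>n\<close>. Positivity of \<open>szego_norm\<close> gives \<open>|\<gamma>\<^sub>n| < 1\<close>, so that the \<open>\<star>\<close>-inverses of the Schur
  algorithm are genuine.
\<close>

lemma szego_orthogonal: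
  assumes herm: "hermitian c" and c0: "c 0 = 1" and nontriv: "nontrivial c"
    and car: "caratheodory c = (1 + fps_X * f 0) * inverse (1 - fps_X * f 0)"
    and \<gamma>: "\<And>n. \<gamma> n = fps_nth (f n) 0"
    and schur: "\<And>n. fps_X * f (Suc n) =
      (f n - fps_const (\<gamma> n)) * inverse (1 - fps_const (qcnj (\<gamma> n)) * f n)"
  shows "(\<forall>m<n. left_moment c (szego_P \<gamma> n) (int m) = 0) \<and>
    (\<forall>m. 0 < m \<and> m \<le> n \<longrightarrow> left_moment c (szego_Q \<gamma> n) (int m) = 0) \<and>
    left_moment c (szego_P \<gamma> n) (int n) = of_real (szego_norm \<gamma> n) \<and>
    left_moment c (szego_Q \<gamma> n) 0 = of_real (szego_norm \<gamma> n) \<and>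
    szego_norm \<gamma> n > 0 \<and>
    f n * residual_P c \<gamma> n = residual_Q c \<gamma> n"
proof (induction n)
  case 0
  show ?case
    using caratheodory_residual[OF c0 car, of \<gamma>] by (auto simp: szego_norm_def c0)
next
  case (Suc n)
  let ?P = "szego_P \<gamma>" and ?Q = "szego_Q \<gamma>" and ?h = "szego_norm \<gamma> n"
  have P: "left_moment c (?P n) (int m) = 0" if "m < n" for m
    using Suc.IH that by blast
  have Q: "left_moment c (?Q n) (int m) = 0" if "0 < m" "m \<le> n" for m
    using Suc.IH that by blast
  have hP: "left_moment c (?P n) (int n) = of_real ?h"
    and hQ: "left_moment c (?Q n) 0 = of_real ?h" and h: "?h > 0"
    and f: "f n * residual_P c \<gamma> n = residual_Q c \<gamma> n"
    using Suc.IH by blast+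
  have Q_next: "left_moment c (?Q n) (int (Suc n)) = \<gamma> n * left_moment c (?P n) (int n)"
    using arg_cong[OF f, of "\<lambda>g. fps_nth g 0"]
    by (simp add: residual_P_def residual_Q_def \<gamma> fps_mult_nth)
  have P_prev: "left_moment c (?P n) (- 1) = ?h *\<^sub>R qcnj (\<gamma> n)"
    using szego_moment_sym[OF herm P Q] by (simp add: Q_next hP del: of_nat_Suc)
  have norm_Suc: "szego_norm \<gamma> (Suc n) = ?h - ?h * (norm (\<gamma> n))\<^sup>2"
    by (simp add: szego_norm_def algebra_simps)
  \<comment> \<open>At \<open>m = 0\<close> the terms from \<open>P_prev\<close> and
    \<open>hQ\<close> cancel; at larger \<open>m\<close> both moments already vanish.\<close>
  have P_orth: "left_moment c (?P (Suc n)) (int m) = 0" if "m < Suc n" for m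
  proof (cases m)
    case 0
    then show ?thesis
      by (simp add: left_moment_diff left_moment_scale left_moment_pCons_0 P_prev hQ)
  next
    case (Suc k)
    with that show ?thesis
      using P[of k] Q[of "Suc k"]
      by (simp add: left_moment_diff left_moment_scale left_moment_pCons_0)
  qed
  have Q_orth: "left_moment c (?Q (Suc n)) (int m) = 0" if "0 < m" "m \<le> Suc n" for m
  proof (cases "m = Suc n")
    case True
    then show ?thesis
      using Q_next by (simp add: left_moment_diff left_moment_scale left_moment_pCons_0)
  next
    case False
    with that obtain k where "m = Suc k" "k < n"
      by (cases m) auto
    then show ?thesis
      using P[of k] Q[of m]
      by (simp add: left_moment_diff left_moment_scale left_moment_pCons_0)
  qed
  have hP_Suc: "left_moment c (?P (Suc n)) (int (Suc n)) = of_real (szego_norm \<gamma> (Suc n))"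
    using Q_next hP qcnj_mult_self(1)[of "\<gamma> n"]
    by (simp add: norm_Suc left_moment_diff left_moment_scale left_moment_pCons_0 of_real_def
        scaleR_diff_left)
  have hQ_Suc: "left_moment c (?Q (Suc n)) 0 = of_real (szego_norm \<gamma> (Suc n))"
    using P_prev hQ qcnj_mult_self(2)[of "\<gamma> n"]
    by (simp add: norm_Suc left_moment_diff left_moment_scale left_moment_pCons_0 of_real_def
        scaleR_diff_left)
  \<comment> \<open>Only the leading coefficient meets a nonzero moment, so
    \<open>szego_norm\<close> is the squared norm, and nontriviality makes it positive.\<close>
  have "ip_L c (?P (Suc n)) (?P (Suc n)) = of_real (szego_norm \<gamma> (Suc n))"
  proof -
    have "ip_L c (?P (Suc n)) (?P (Suc n))
        = (\<Sum>l\<le>Suc n. if l = Suc n then of_real (szego_norm \<gamma> (Suc n)) else 0)"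
      unfolding ip_L_eq_left_moments[OF szego_degree(1)]
      using P_orth hP_Suc szego_degree(2)[of \<gamma> "Suc n"]
      by (intro sum.cong) (auto simp del: szego_P.simps of_nat_Suc)
    then show ?thesis
      by simp
  qed
  then have h_Suc: "szego_norm \<gamma> (Suc n) > 0"
    using ip_L_self_pos[OF nontriv degree_szego_P, of \<gamma> "Suc n"] szego_degree(2)[of \<gamma> "Suc n"]
    by (metis qRe_of_real zero_neq_one)
  have "f (Suc n) * residual_P c \<gamma> (Suc n) = residual_Q c \<gamma> (Suc n)"
  proof -
    let ?d = "1 - fps_const (qcnj (\<gamma> n)) * f n"
    have "(norm (\<gamma> n))\<^sup>2 \<noteq> 1"
      using h_Suc norm_Suc by auto
    then have "fps_nth ?d 0 \<noteq> 0"
      by (simp add: \<gamma>[symmetric] qcnj_mult_self flip: of_real_power)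
    then have d: "inverse ?d * ?d = 1"
      by (rule inverse_mult_eq_1)
    have "residual_P c \<gamma> (Suc n) = ?d * residual_P c \<gamma> n"
      by (simp add: residual_P_Suc left_diff_distrib mult.assoc f)
    then have "fps_X * f (Suc n) * residual_P c \<gamma> (Suc n)
        = (f n - fps_const (\<gamma> n)) * (inverse ?d * ?d) * residual_P c \<gamma> n"
      by (simp only: schur mult.assoc)
    also have "\<dots> = fps_X * residual_Q c \<gamma> (Suc n)"
      by (simp add: d left_diff_distrib f residual_Q_Suc[OF Q_next])
    finally have "fps_nth (fps_X * (f (Suc n) * residual_P c \<gamma> (Suc n))) (Suc k)
        = fps_nth (fps_X * residual_Q c \<gamma> (Suc n)) (Suc k)" for k
      by (simp only: mult.assoc)
    then show ?thesis
      unfolding fps_X_mult_nth by (simp add: fps_eq_iff)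
  qed
  with P_orth Q_orth hP_Suc hQ_Suc h_Suc show ?case
    by blast
qed

section \<open>Evaluation\<close>

lemma eval_left_coeffs_upto:
  "degree \<phi> \<le> N \<Longrightarrow> eval_left_coeffs \<phi> p = (\<Sum>k\<le>N. coeff \<phi> k * p ^ k)"
  unfolding eval_left_coeffs_def by (rule sum_upto_degree_eq) simp

lemma eval_right_coeffs_upto:
  "degree \<phi> \<le> N \<Longrightarrow> eval_right_coeffs \<phi> p = (\<Sum>k\<le>N. p ^ k * coeff \<phi> k)"
  unfolding eval_right_coeffs_def by (rule sum_upto_degree_eq) simp

lemma eval_left_coeffs_pCons_0: "eval_left_coeffs (pCons 0 \<phi>) p = eval_left_coeffs \<phi> p * p"
  unfolding eval_left_coeffs_upto[OF degree_pCons_le] sum.atMost_Suc_shift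
  by (simp add: eval_left_coeffs_def sum_distrib_right power_commutes mult.assoc)

lemma eval_right_coeffs_pCons_0: "eval_right_coeffs (pCons 0 \<phi>) p = p * eval_right_coeffs \<phi> p"
  unfolding eval_right_coeffs_upto[OF degree_pCons_le] sum.atMost_Suc_shift
  by (simp add: eval_right_coeffs_def sum_distrib_left mult.assoc)

lemma eval_left_coeffs_diff:
  "eval_left_coeffs (\<phi> - \<psi>) p = eval_left_coeffs \<phi> p - eval_left_coeffs \<psi> p"
  by (simp add: eval_left_coeffs_upto[where N = "max (degree \<phi>) (degree \<psi>)"] degree_diff_le
      sum_subtractf left_diff_distrib)

lemma eval_right_coeffs_diff:
  "eval_right_coeffs (\<phi> - \<psi>) p = eval_right_coeffs \<phi> p - eval_right_coeffs \<psi> p"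
  by (simp add: eval_right_coeffs_upto[where N = "max (degree \<phi>) (degree \<psi>)"] degree_diff_le
      sum_subtractf right_diff_distrib)

lemma eval_left_coeffs_scale: "eval_left_coeffs (scale_left a \<phi>) p = a * eval_left_coeffs \<phi> p"
  by (simp add: eval_left_coeffs_upto[where N = "degree \<phi>"] degree_scale_left_le
      sum_distrib_left mult.assoc)

lemma eval_right_coeffs_scale: "eval_right_coeffs (scale_right \<phi> a) p = eval_right_coeffs \<phi> p * a"
proof -
  have "degree (scale_right \<phi> a) \<le> degree \<phi>"
    by (intro degree_le) (simp add: coeff_eq_0)
  then show ?thesis
    by (simp add: eval_right_coeffs_upto[where N = "degree \<phi>"] sum_distrib_right mult.assoc)
qed

section \<open>Normalization of the Szego recursion\<close>

theorem theorem5p3: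
  fixes i j :: quat and \<mu> :: "quat set \<Rightarrow> quat" and c :: "int \<Rightarrow> quat"
    and \<gamma> :: "nat \<Rightarrow> quat" and r :: "nat \<Rightarrow> real"
  assumes "i \<in> imag_sphere" and "j \<in> imag_sphere" and "i \<bullet> j = 0"
    and "q_positive i j \<mu>"
    and c_def: "c = moment i \<mu>"
    and "c 0 = 1" and "nontrivial c"
    and "verblunsky_coeffs c \<gamma>"
    and r_def: "r = (\<lambda>n. sqrt (1 - (norm (\<gamma> n))\<^sup>2))"
  shows "\<forall>n p.
    eval_left_coeffs (psi_L c n) p * p - of_real (r n) * eval_left_coeffs (psi_L c (n + 1)) p
      = qcnj (\<gamma> n) * eval_left_coeffs (reverse_poly (psi_R c n)) p \<and>
    p * eval_right_coeffs (psi_R c n) p - eval_right_coeffs (psi_R c (n + 1)) p * of_real (r n)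
      = eval_right_coeffs (reverse_poly (psi_L c n)) p * qcnj (\<gamma> n)"
proof -
  obtain f where car: "caratheodory c = (1 + fps_X * f 0) * inverse (1 - fps_X * f 0)"
    and \<gamma>: "\<And>n. \<gamma> n = fps_nth (f n) 0"
    and schur: "\<And>n. fps_X * f (Suc n) =
      (f n - fps_const (\<gamma> n)) * inverse (1 - fps_const (qcnj (\<gamma> n)) * f n)"
    using assms(8) unfolding verblunsky_coeffs_def by blast
  have herm: "hermitian c"
    using assms(7,6) by (rule hermitian_if_nontrivial)
  let ?P = "szego_P \<gamma>" and ?Q = "szego_Q \<gamma>" and ?h = "szego_norm \<gamma>" and ?c = "\<lambda>n. c (- n)"
  note szego = szego_orthogonal[where f = f, OF herm assms(6,7) car \<gamma> schur]
  interpret L: monic_orthogonal c ?P ?h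
    using herm szego by unfold_locales (simp_all add: degree_szego_P szego_degree)
  have degree_R: "degree (reverse_at n (?Q n)) = n" for n
    using degree_reverse_at_le[of n "?Q n"]
    by (intro antisym le_degree) (simp_all add: coeff_reverse_at szego_degree)
  interpret R: monic_orthogonal ?c "\<lambda>n. reverse_at n (?Q n)" ?h
  proof
    show "hermitian ?c"
      using herm by (simp add: hermitian_def)
    show "left_moment ?c (reverse_at n (?Q n)) (int m) = 0" if "m < n" for m n
      using szego[of n, THEN conjunct2, THEN conjunct1, rule_format, of "n - m"] that
      by (simp add: left_moment_reverse_at szego_degree)
    show "left_moment ?c (reverse_at n (?Q n)) (int n) = of_real (?h n)" for n
      using szego[of n] by (simp add: left_moment_reverse_at szego_degree)
  qed (simp_all add: degree_R coeff_reverse_at szego_degree L.h_pos)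
  define s where "s n = 1 / sqrt (?h n)" for n
  have s_nz: "s n \<noteq> 0" for n
    using L.h_pos[of n] by (simp add: s_def)
  \<comment> \<open>The last factor of the product \<open>?h (Suc n)\<close> is the square of
    \<open>r n\<close>.\<close>
  have r_s: "r n * s (Suc n) = s n" for n
  proof -
    have h: "?h (Suc n) = ?h n * (1 - (norm (\<gamma> n))\<^sup>2)"
      by (simp add: szego_norm_def)
    then have "1 - (norm (\<gamma> n))\<^sup>2 > 0"
      using L.h_pos[of n] L.h_pos[of "Suc n"] by (simp add: zero_less_mult_iff)
    then show ?thesis
      unfolding s_def h r_def real_sqrt_mult by simp
  qed
  have psi_L: "psi_L c n = scale_left (of_real (s n)) (?P n)" for n
    using L.psi_L_eq[of n] by (simp only: s_def)
  have coeff_psi_L: "coeff (psi_L c n) k = s n *\<^sub>R coeff (?P n) k" for n k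
    by (simp add: psi_L)
  have psi_R: "psi_R c n = map_poly qcnj (scale_left (of_real (s n)) (reverse_at n (?Q n)))" for n
    using R.psi_L_eq[of n] psi_R_eq_psi_L[OF herm, of n] by (simp only: s_def)
  have coeff_psi_R: "coeff (psi_R c n) k = (if k \<le> n then s n *\<^sub>R qcnj (coeff (?Q n) (n - k)) else 0)"
    for n k
    by (simp add: psi_R coeff_map_poly coeff_reverse_at)
  \<comment> \<open>\<open>reverse_poly\<close> undoes the conjugation and reversal in
    \<open>psi_R\<close>, leaving the normalized \<open>?Q n\<close>.\<close>
  have coeff_reverse_psi_R: "coeff (reverse_poly (psi_R c n)) k = s n *\<^sub>R coeff (?Q n) k" for n k
  proof -
    have "degree (map_poly qcnj (psi_R c n)) = n"
      using s_nz by (simp add: psi_R degree_map_poly degree_scale_left degree_R)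
    then show ?thesis
      using szego_degree(3)[of \<gamma> n]
      by (simp add: reverse_poly_def coeff_reflect_poly coeff_map_poly coeff_psi_R coeff_eq_0)
  qed
  have coeff_reverse_psi_L: "coeff (reverse_poly (psi_L c n)) k
      = (if k \<le> n then s n *\<^sub>R qcnj (coeff (?P n) (n - k)) else 0)" for n k
  proof -
    have "degree (map_poly qcnj (psi_L c n)) = n"
      using s_nz by (simp add: psi_L degree_map_poly degree_scale_left degree_szego_P)
    then show ?thesis
      by (simp add: reverse_poly_def coeff_reflect_poly coeff_map_poly coeff_psi_L)
  qed
  have left: "pCons 0 (psi_L c n) - scale_left (of_real (r n)) (psi_L c (Suc n))
      = scale_left (qcnj (\<gamma> n)) (reverse_poly (psi_R c n))" for n
    by (rule poly_eqI)
      (simp add: coeff_psi_L coeff_reverse_psi_R coeff_pCons r_s algebra_simps split: nat.split)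
  \<comment> \<open>This is the recursion for \<open>?Q\<close> read from the top coefficient down;
    conjugation moves the Verblunsky coefficient to the right.\<close>
  have right: "pCons 0 (psi_R c n) - scale_right (psi_R c (Suc n)) (of_real (r n))
      = scale_right (reverse_poly (psi_L c n)) (qcnj (\<gamma> n))" for n
  proof (rule poly_eqI)
    fix k
    \<comment> \<open>At \<open>k = 0\<close> the recursion reads \<open>?Q n\<close> one past its
      degree bound.\<close>
    have top: "coeff (?Q n) (Suc n) = 0"
      using szego_degree(3)[of \<gamma> n] by (simp add: coeff_eq_0)
    show "coeff (pCons 0 (psi_R c n) - scale_right (psi_R c (Suc n)) (of_real (r n))) k
        = coeff (scale_right (reverse_poly (psi_L c n)) (qcnj (\<gamma> n))) k"
    proof (cases "k \<le> n")
      case True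
      then have "Suc n - k = Suc (n - k)"
        by simp
      with True top show ?thesis
        by (cases k) (simp_all add: coeff_psi_R coeff_reverse_psi_L r_s algebra_simps)
    next
      case False
      then show ?thesis
        by (cases "k = Suc n")
          (simp_all add: coeff_psi_R coeff_reverse_psi_L coeff_pCons r_s szego_degree
            split: nat.split)
    qed
  qed
  show ?thesis
    unfolding Suc_eq_plus1[symmetric] eval_left_coeffs_pCons_0[symmetric]
      eval_right_coeffs_pCons_0[symmetric] eval_left_coeffs_scale[symmetric]
      eval_right_coeffs_scale[symmetric] eval_left_coeffs_diff[symmetric]
      eval_right_coeffs_diff[symmetric] left right
    by simp
qed

end
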